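(* Let $A=\bigoplus_{i\in\mathbb{N}}A_i$ be an $\mathbb{N}$-graded ring and let $M=\bigoplus_{i\in\mathbb{N}}M_i$ be an $\mathbb{N}$-graded $A$-module. Then the $A$-module $(M,\deg_M)$ is a Euclidean module if and only if for all natural numbers $i\le j$ and all elements $m_i\in M_i\setminus\{0\}$, $M_j=A_{j-i}m_i$. If the $A$-module $(M,\deg_M)$ is a Euclidean module then all $A_0$-modules $M_i$ are simple modules.
   Context: Rings are unital, modules are left modules, $\mathbb{N}=\{0,1,2,\ldots\}$. For a nonzero $m=\sum_im_i\in M$ with $m_i\in M_i$, $\deg_M(m):=\max\{i:m_i\neq0\}$. $(M,\deg_M)$ is a Euclidean module (with Euclidean function $\deg_M$) if for any nonzero $u,v\in M$ there are $q\in A$ and $r\in M$ with $u=qv+r$ and either $r=0$ or $\deg_M(r)<\deg_M(v)$.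
   Formalization: The last sentence is proved for the nonzero M_i only: a simple module is nonzero by definition, and some M_i can be zero (e.g. A = M = a field in degree 0 is Euclidean, but M_1 = 0). *)

theory Defs
  imports "HOL-Algebra.Module" "HOL-Algebra.AbelCoset"
begin

text \<open>The library locale \<open>module\<close> requires a commutative base ring; the following
  is the same notion over an arbitrary unital ring.\<close>

locale left_module = R?: ring R + M?: abelian_group M
  for R (structure) and M :: "('a, 'm, 'c) module_scheme" (structure) +
  assumes smult_closed [simp, intro]:
      "\<lbrakk>a \<in> carrier R; x \<in> carrier M\<rbrakk> \<Longrightarrow> a \<odot>\<^bsub>M\<^esub> x \<in> carrier M"
    and smult_l_distr:
      "\<lbrakk>a \<in> carrier R; b \<in> carrier R; x \<in> carrier M\<rbrakk> \<Longrightarrow>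
        (a \<oplus> b) \<odot>\<^bsub>M\<^esub> x = a \<odot>\<^bsub>M\<^esub> x \<oplus>\<^bsub>M\<^esub> b \<odot>\<^bsub>M\<^esub> x"
    and smult_r_distr:
      "\<lbrakk>a \<in> carrier R; x \<in> carrier M; y \<in> carrier M\<rbrakk> \<Longrightarrow>
        a \<odot>\<^bsub>M\<^esub> (x \<oplus>\<^bsub>M\<^esub> y) = a \<odot>\<^bsub>M\<^esub> x \<oplus>\<^bsub>M\<^esub> a \<odot>\<^bsub>M\<^esub> y"
    and smult_assoc1:
      "\<lbrakk>a \<in> carrier R; b \<in> carrier R; x \<in> carrier M\<rbrakk> \<Longrightarrow>
        (a \<otimes> b) \<odot>\<^bsub>M\<^esub> x = a \<odot>\<^bsub>M\<^esub> (b \<odot>\<^bsub>M\<^esub> x)"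
    and smult_one [simp]:
      "x \<in> carrier M \<Longrightarrow> \<one> \<odot>\<^bsub>M\<^esub> x = x"

text \<open>The zero module is not simple.\<close>

locale simple_module = left_module R M for R (structure) and M (structure) +
  assumes nonzero: "carrier M \<noteq> {\<zero>\<^bsub>M\<^esub>}"
    and submodule_trivial: "submodule N R M \<Longrightarrow> N = {\<zero>\<^bsub>M\<^esub>} \<or> N = carrier M"

definition homogeneous_decomposition ::
    "('a, 'm) ring_scheme \<Rightarrow> (nat \<Rightarrow> 'a set) \<Rightarrow> 'a \<Rightarrow> (nat \<Rightarrow> 'a) \<Rightarrow> bool" where
  "homogeneous_decomposition G Gr x c \<longleftrightarrow>
     (\<forall>i. c i \<in> Gr i) \<and> finite {i. c i \<noteq> \<zero>\<^bsub>G\<^esub>} \<and>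
     x = (\<Oplus>\<^bsub>G\<^esub>i\<in>{i. c i \<noteq> \<zero>\<^bsub>G\<^esub>}. c i)"

definition internal_direct_sum :: "('a, 'm) ring_scheme \<Rightarrow> (nat \<Rightarrow> 'a set) \<Rightarrow> bool" where
  "internal_direct_sum G Gr \<longleftrightarrow>
     (\<forall>i. additive_subgroup (Gr i) G) \<and>
     (\<forall>x\<in>carrier G. \<exists>!c. homogeneous_decomposition G Gr x c)"

text \<open>That \<open>\<one>\<close> has degree \<open>0\<close> is a consequence of these axioms.\<close>

locale graded_ring = ring R for R (structure) +
  fixes Rgr :: "nat \<Rightarrow> 'a set"
  assumes ring_direct_sum: "internal_direct_sum R Rgr"
    and graded_mult: "\<lbrakk>a \<in> Rgr i; b \<in> Rgr j\<rbrakk> \<Longrightarrow> a \<otimes> b \<in> Rgr (i + j)"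

locale graded_module = graded_ring R Rgr + left_module R M
  for R (structure) and Rgr and M (structure) +
  fixes Mgr :: "nat \<Rightarrow> 'c set"
  assumes module_direct_sum: "internal_direct_sum M Mgr"
    and graded_smult: "\<lbrakk>a \<in> Rgr i; x \<in> Mgr j\<rbrakk> \<Longrightarrow> a \<odot>\<^bsub>M\<^esub> x \<in> Mgr (i + j)"

definition homogeneous_component ::
    "('a, 'm) ring_scheme \<Rightarrow> (nat \<Rightarrow> 'a set) \<Rightarrow> 'a \<Rightarrow> nat \<Rightarrow> 'a" where
  "homogeneous_component G Gr x = (THE c. homogeneous_decomposition G Gr x c)"

text \<open>Only meaningful for nonzero elements of the carrier.\<close>

definition graded_deg :: "('a, 'm) ring_scheme \<Rightarrow> (nat \<Rightarrow> 'a set) \<Rightarrow> 'a \<Rightarrow> nat" where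
  "graded_deg G Gr x = Max {i. homogeneous_component G Gr x i \<noteq> \<zero>\<^bsub>G\<^esub>}"

locale euclidean_module = left_module R M for R (structure) and M (structure) +
  fixes \<phi> :: "'c \<Rightarrow> nat"
  assumes euclidean_division:
    "\<lbrakk>u \<in> carrier M - {\<zero>\<^bsub>M\<^esub>}; v \<in> carrier M - {\<zero>\<^bsub>M\<^esub>}\<rbrakk> \<Longrightarrow>
      \<exists>q\<in>carrier R. \<exists>r\<in>carrier M.
        u = q \<odot>\<^bsub>M\<^esub> v \<oplus>\<^bsub>M\<^esub> r \<and> (r = \<zero>\<^bsub>M\<^esub> \<or> \<phi> r < \<phi> v)"

end

theory Submission
  imports Defs
begin

text \<open>Comparing components of degree \<open>j \<ge> i\<close> in \<open>n = q m + r\<close>, with \<open>n\<close> homogeneous of degree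
  \<open>j\<close>, \<open>m\<close> homogeneous of degree \<open>i\<close> and \<open>deg r < i\<close>, gives \<open>n = q\<^sub>j\<^sub>-\<^sub>i m\<close>. Conversely,
  if \<open>M\<^sub>j = A\<^sub>j\<^sub>-\<^sub>i m\<close> always holds, the leading component of \<open>u\<close> is a multiple of that of \<open>v\<close>
  whenever \<open>deg u \<ge> deg v\<close>, and long division terminates. The case \<open>i = j\<close> says that every
  nonzero element of \<open>M\<^sub>i\<close> generates \<open>M\<^sub>i\<close> over \<open>A\<^sub>0\<close>.\<close>

section \<open>Homogeneous components\<close>

text \<open>Isolates the additive part of a grading, so that one theory of components and degrees
  serves both the ring and the module.\<close>

locale graded_group = abelian_group G for G (structure) +
  fixes Gr :: "nat \<Rightarrow> 'a set"
  assumes direct_sum: "internal_direct_sum G Gr"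
begin

abbreviation comp :: "'a \<Rightarrow> nat \<Rightarrow> 'a" where
  "comp \<equiv> homogeneous_component G Gr"

lemma additive_subgroup_Gr: "additive_subgroup (Gr i) G"
  using direct_sum by (simp add: internal_direct_sum_def)

lemma Gr_carrier: "x \<in> Gr i \<Longrightarrow> x \<in> carrier G"
  using additive_subgroup.a_Hcarr[OF additive_subgroup_Gr] .

lemma Gr_zero [simp]: "\<zero> \<in> Gr i"
  using additive_subgroup.zero_closed[OF additive_subgroup_Gr] .

lemma Gr_add: "x \<in> Gr i \<Longrightarrow> y \<in> Gr i \<Longrightarrow> x \<oplus> y \<in> Gr i"
  using additive_subgroup.a_closed[OF additive_subgroup_Gr] .

lemma comp_decomposition:
  assumes "x \<in> carrier G"
  shows "homogeneous_decomposition G Gr x (comp x)"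
  unfolding homogeneous_component_def
  by (rule theI'[of "homogeneous_decomposition G Gr x"])
    (use direct_sum assms in \<open>simp add: internal_direct_sum_def\<close>)

lemma comp_eqI:
  assumes "x \<in> carrier G" "homogeneous_decomposition G Gr x c"
  shows "comp x = c"
  using direct_sum comp_decomposition[OF assms(1)] assms
  unfolding internal_direct_sum_def by blast

lemma comp_in_Gr: "x \<in> carrier G \<Longrightarrow> comp x i \<in> Gr i"
  using comp_decomposition by (simp add: homogeneous_decomposition_def)

lemma comp_closed [simp]: "x \<in> carrier G \<Longrightarrow> comp x i \<in> carrier G"
  using comp_in_Gr Gr_carrier by blast

lemma finite_support: "x \<in> carrier G \<Longrightarrow> finite {i. comp x i \<noteq> \<zero>}"
  using comp_decomposition by (simp add: homogeneous_decomposition_def)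

text \<open>Terms off the support are zero, so decompositions of different elements can be summed
  over one common finite index set.\<close>

lemma finsum_support:
  assumes "finite S" "\<And>i. i \<notin> S \<Longrightarrow> c i = \<zero>" "\<And>i. c i \<in> Gr i"
  shows "(\<Oplus>i\<in>{i. c i \<noteq> \<zero>}. c i) = (\<Oplus>i\<in>S. c i)"
  by (rule add.finprod_mono_neutral_cong_left) (use assms Gr_carrier in auto)

lemma decompositionI:
  assumes "finite S" "\<And>i. i \<notin> S \<Longrightarrow> c i = \<zero>" "\<And>i. c i \<in> Gr i" "x = (\<Oplus>i\<in>S. c i)"
  shows "homogeneous_decomposition G Gr x c"
proof -
  have "{i. c i \<noteq> \<zero>} \<subseteq> S" using assms(2) by auto
  then show ?thesis
    using assms finsum_support[OF assms(1-3)] finite_subset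
    unfolding homogeneous_decomposition_def by auto
qed

lemma finsum_comp:
  assumes "x \<in> carrier G" "finite S" "\<And>i. i \<notin> S \<Longrightarrow> comp x i = \<zero>"
  shows "x = (\<Oplus>i\<in>S. comp x i)"
proof -
  have "x = (\<Oplus>i\<in>{i. comp x i \<noteq> \<zero>}. comp x i)"
    using comp_decomposition[OF assms(1)] by (simp add: homogeneous_decomposition_def)
  also have "\<dots> = (\<Oplus>i\<in>S. comp x i)"
    using assms by (intro finsum_support) (auto simp: comp_in_Gr)
  finally show ?thesis .
qed

lemma comp_homogeneous:
  assumes "x \<in> Gr n"
  shows "comp x = (\<lambda>i. if i = n then x else \<zero>)"
  using assms Gr_carrier
  by (intro comp_eqI decompositionI[of "{n}"]) auto

lemma comp_add:
  assumes "x \<in> carrier G" "y \<in> carrier G"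
  shows "comp (x \<oplus> y) i = comp x i \<oplus> comp y i"
proof -
  \<comment> \<open>By cancellation the support of the sum may be smaller than this union;
    \<open>decompositionI\<close> accepts any finite superset.\<close>
  let ?S = "{i. comp x i \<noteq> \<zero>} \<union> {i. comp y i \<noteq> \<zero>}"
  have fin: "finite ?S" using assms finite_support by simp
  have "(\<Oplus>i\<in>?S. comp x i \<oplus> comp y i) = (\<Oplus>i\<in>?S. comp x i) \<oplus> (\<Oplus>i\<in>?S. comp y i)"
    using assms by (intro finsum_addf) auto
  also have "\<dots> = x \<oplus> y"
    using assms fin by (intro arg_cong2[of _ _ _ _ "(\<oplus>)"] finsum_comp[symmetric]) auto
  finally have "homogeneous_decomposition G Gr (x \<oplus> y) (\<lambda>i. comp x i \<oplus> comp y i)"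
    using assms fin by (intro decompositionI[of ?S]) (auto simp: comp_in_Gr Gr_add)
  then show ?thesis using comp_eqI assms by auto
qed

text \<open>Every element is a finite sum of its components, so additive identities need checking on
  homogeneous elements only. The empty sum is covered since zero is homogeneous of degree 0.\<close>

lemma homogeneous_induct [consumes 1, case_names homogeneous add]:
  assumes "x \<in> carrier G"
    and hom: "\<And>n x. x \<in> Gr n \<Longrightarrow> P x"
    and add: "\<And>x y. x \<in> carrier G \<Longrightarrow> y \<in> carrier G \<Longrightarrow> P x \<Longrightarrow> P y \<Longrightarrow> P (x \<oplus> y)"
  shows "P x"
proof -
  have "P (\<Oplus>i\<in>S. comp x i)" if "finite S" for S
    using that
  proof induction
    case empty
    show ?case using hom[of \<zero> 0] by simp
  next
    case (insert n S)
    then show ?case using assms(1) hom[of "comp x n" n]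
      by (auto simp: comp_in_Gr finsum_insert intro!: add finsum_closed)
  qed
  then show ?thesis
    using finite_support[OF assms(1)] finsum_comp[OF assms(1) finite_support[OF assms(1)]] by force
qed

lemma ex_comp_nonzero:
  assumes "x \<in> carrier G" "x \<noteq> \<zero>"
  shows "\<exists>i. comp x i \<noteq> \<zero>"
  using finsum_comp[of x "{}"] assms by auto

lemma comp_zero [simp]: "comp \<zero> i = \<zero>"
  using comp_homogeneous[of \<zero> 0] by simp

lemma comp_deg_nonzero:
  assumes "x \<in> carrier G" "x \<noteq> \<zero>"
  shows "comp x (graded_deg G Gr x) \<noteq> \<zero>"
  using Max_in[OF finite_support[OF assms(1)]] ex_comp_nonzero[OF assms]
  by (auto simp: graded_deg_def)

text \<open>This includes x = 0: its degree is the unspecified maximum of the empty set, but all its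
  components vanish.\<close>

lemma comp_above_deg:
  assumes "x \<in> carrier G" "graded_deg G Gr x < i"
  shows "comp x i = \<zero>"
proof (rule ccontr)
  assume "comp x i \<noteq> \<zero>"
  then have "i \<le> graded_deg G Gr x"
    using Max_ge[OF finite_support[OF assms(1)]] by (simp add: graded_deg_def)
  then show False using assms by simp
qed

lemma deg_lessI:
  assumes "x \<in> carrier G" "x \<noteq> \<zero>" "\<And>i. n \<le> i \<Longrightarrow> comp x i = \<zero>"
  shows "graded_deg G Gr x < n"
  using comp_deg_nonzero[OF assms(1,2)] assms(3) not_le by blast

lemma deg_homogeneous:
  assumes "x \<in> Gr n" "x \<noteq> \<zero>"
  shows "graded_deg G Gr x = n"
  using comp_deg_nonzero[of x] assms Gr_carrier
  by (auto simp: comp_homogeneous[OF assms(1)] split: if_splits)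

end

text \<open>Both sides are additive in x, and for homogeneous x both are f x or zero. Multiplication
  by a homogeneous element, on either side, is such a map f. Writing the degree as d + k avoids
  truncated subtraction.\<close>

lemma comp_graded_hom:
  fixes G (structure) and H (structure)
  assumes "graded_group G Gr" "graded_group H Hr"
    and closed: "\<And>x. x \<in> carrier G \<Longrightarrow> f x \<in> carrier H"
    and additive: "\<And>x y. x \<in> carrier G \<Longrightarrow> y \<in> carrier G \<Longrightarrow> f (x \<oplus>\<^bsub>G\<^esub> y) = f x \<oplus>\<^bsub>H\<^esub> f y"
    and graded: "\<And>n x. x \<in> Gr n \<Longrightarrow> f x \<in> Hr (d + n)"
    and "x \<in> carrier G"
  shows "homogeneous_component H Hr (f x) (d + k) = f (homogeneous_component G Gr x k)"
proof -
  interpret G: graded_group G Gr by fact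
  interpret H: graded_group H Hr by fact
  have "f \<zero>\<^bsub>G\<^esub> \<oplus>\<^bsub>H\<^esub> f \<zero>\<^bsub>G\<^esub> = f \<zero>\<^bsub>G\<^esub>"
    using additive[of "\<zero>\<^bsub>G\<^esub>" "\<zero>\<^bsub>G\<^esub>"] by simp
  then have zero: "f \<zero>\<^bsub>G\<^esub> = \<zero>\<^bsub>H\<^esub>" using closed by simp
  show ?thesis using \<open>x \<in> carrier G\<close>
  proof (induction rule: G.homogeneous_induct)
    case (homogeneous n x)
    then show ?case using graded
      by (simp add: zero G.comp_homogeneous[OF homogeneous] H.comp_homogeneous[OF graded])
  next
    case (add x y)
    then show ?case by (simp add: additive closed G.comp_add H.comp_add)
  qed
qed

section \<open>The subring of degree zero\<close>

sublocale graded_ring \<subseteq> A: graded_group R Rgr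
  by unfold_locales (rule ring_direct_sum)

text \<open>The degree-0 component \<open>e\<close> of \<open>\<one>\<close> satisfies \<open>x \<otimes> e = x\<close> for homogeneous \<open>x\<close>, hence for
  \<open>x = \<one>\<close>.\<close>

lemma (in graded_ring) one_degree_zero: "\<one> \<in> Rgr 0"
proof -
  have "x \<otimes> A.comp \<one> 0 = x" if "x \<in> carrier R" for x
    using that
  proof (induction rule: A.homogeneous_induct)
    case (homogeneous n x)
    then have "A.comp (x \<otimes> \<one>) (n + 0) = x \<otimes> A.comp \<one> 0"
      by (intro comp_graded_hom[OF A.graded_group_axioms A.graded_group_axioms])
        (auto simp: A.Gr_carrier r_distr graded_mult)
    then show ?case using homogeneous by (simp add: A.Gr_carrier A.comp_homogeneous[OF homogeneous])
  next
    case (add x y)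
    then show ?case by (simp add: l_distr)
  qed
  from this[of \<one>] show ?thesis using A.comp_in_Gr[of \<one> 0] by simp
qed

lemma (in graded_ring) ring_degree_zero: "ring (R\<lparr>carrier := Rgr 0\<rparr>)"
proof -
  have closed: "\<And>x y. x \<in> Rgr 0 \<Longrightarrow> y \<in> Rgr 0 \<Longrightarrow> x \<otimes> y \<in> Rgr 0"
    using graded_mult[of _ 0 _ 0] by simp
  have neg: "\<And>x. x \<in> Rgr 0 \<Longrightarrow> \<ominus> x \<in> Rgr 0"
    using additive_subgroup.a_inv_closed[OF A.additive_subgroup_Gr] .
  show ?thesis
    by (intro ringI abelian_groupI monoidI)
      (auto simp: closed A.Gr_add A.Gr_carrier a_assoc a_comm a_lcomm m_assoc l_distr r_distr
        one_degree_zero intro!: bexI[of _ "\<ominus> x" for x] r_neg neg)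
qed

lemma (in left_module) zero_smult [simp]:
  assumes "x \<in> carrier M"
  shows "\<zero>\<^bsub>R\<^esub> \<odot>\<^bsub>M\<^esub> x = \<zero>\<^bsub>M\<^esub>"
proof -
  have "\<zero>\<^bsub>R\<^esub> \<odot>\<^bsub>M\<^esub> x \<oplus>\<^bsub>M\<^esub> \<zero>\<^bsub>R\<^esub> \<odot>\<^bsub>M\<^esub> x = \<zero>\<^bsub>R\<^esub> \<odot>\<^bsub>M\<^esub> x"
    using smult_l_distr[of "\<zero>\<^bsub>R\<^esub>" "\<zero>\<^bsub>R\<^esub>" x] assms by simp
  then show ?thesis using assms by simp
qed

section \<open>Graded modules\<close>

context graded_module
begin

sublocale N: graded_group M Mgr by unfold_locales (rule module_direct_sum)

abbreviation homogeneous_cyclic :: bool where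
  "homogeneous_cyclic \<equiv> \<forall>i j. i \<le> j \<longrightarrow> (\<forall>m \<in> Mgr i - {\<zero>\<^bsub>M\<^esub>}.
     Mgr j = {a \<odot>\<^bsub>M\<^esub> m | a. a \<in> Rgr (j - i)})"

text \<open>Here the vector is homogeneous and the scalar arbitrary, as in the division of n by m;
  \<open>comp_smult_left\<close> has the roles exchanged, as needed for long division.\<close>

lemma comp_smult_right:
  assumes "a \<in> carrier R" "m \<in> Mgr i"
  shows "N.comp (a \<odot>\<^bsub>M\<^esub> m) (i + k) = A.comp a k \<odot>\<^bsub>M\<^esub> m"
  using assms
  by (intro comp_graded_hom[where f = "\<lambda>a. a \<odot>\<^bsub>M\<^esub> m", OF A.graded_group_axioms N.graded_group_axioms])
    (auto simp: N.Gr_carrier smult_l_distr add.commute[of i] graded_smult)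

lemma comp_smult_left:
  assumes "a \<in> Rgr d" "v \<in> carrier M"
  shows "N.comp (a \<odot>\<^bsub>M\<^esub> v) (d + k) = a \<odot>\<^bsub>M\<^esub> N.comp v k"
  using assms
  by (intro comp_graded_hom[OF N.graded_group_axioms N.graded_group_axioms])
    (auto simp: A.Gr_carrier smult_r_distr graded_smult)

section \<open>From Euclidean division to generation by homogeneous elements\<close>

lemma homogeneous_cyclic_if_euclidean:
  assumes "euclidean_module R M (graded_deg M Mgr)"
  shows homogeneous_cyclic
proof (intro allI impI ballI subset_antisym subsetI)
  interpret E: euclidean_module R M "graded_deg M Mgr" by fact
  fix i j m n
  assume ij: "i \<le> j" and m: "m \<in> Mgr i - {\<zero>\<^bsub>M\<^esub>}" and n: "n \<in> Mgr j"
  show "n \<in> {a \<odot>\<^bsub>M\<^esub> m | a. a \<in> Rgr (j - i)}"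
  proof (cases "n = \<zero>\<^bsub>M\<^esub>")
    case True
    \<comment> \<open>Division is available for nonzero n only; here the scalar zero, which lies in
      every component of the ring, does the job.\<close>
    then show ?thesis using m N.Gr_carrier by (intro CollectI exI[of _ "\<zero>"]) auto
  next
    case False
    then obtain q r where q: "q \<in> carrier R" and r: "r \<in> carrier M"
      and eq: "n = q \<odot>\<^bsub>M\<^esub> m \<oplus>\<^bsub>M\<^esub> r"
      and deg: "r = \<zero>\<^bsub>M\<^esub> \<or> graded_deg M Mgr r < graded_deg M Mgr m"
      using E.euclidean_division[of n m] n m N.Gr_carrier by auto
    \<comment> \<open>A nonzero remainder has degree below i, hence below j.\<close>
    have "N.comp r j = \<zero>\<^bsub>M\<^esub>"
      using deg r ij m N.deg_homogeneous[of m i] N.comp_above_deg[of r j] by auto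
    moreover have "N.comp n j = N.comp (q \<odot>\<^bsub>M\<^esub> m) j \<oplus>\<^bsub>M\<^esub> N.comp r j"
      using q r m unfolding eq by (intro N.comp_add) (auto simp: N.Gr_carrier)
    moreover have "N.comp (q \<odot>\<^bsub>M\<^esub> m) j = A.comp q (j - i) \<odot>\<^bsub>M\<^esub> m"
      using comp_smult_right[of q m i "j - i"] q m ij by simp
    moreover have "N.comp n j = n" using N.comp_homogeneous[OF n] by simp
    ultimately have "n = A.comp q (j - i) \<odot>\<^bsub>M\<^esub> m"
      using q m N.Gr_carrier[of m i] by simp
    then show ?thesis using A.comp_in_Gr[OF q] by blast
  qed
next
  fix i j m n
  assume "i \<le> j" "m \<in> Mgr i - {\<zero>\<^bsub>M\<^esub>}" "n \<in> {a \<odot>\<^bsub>M\<^esub> m | a. a \<in> Rgr (j - i)}"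
  then show "n \<in> Mgr j" using graded_smult[of _ "j - i" m i] by auto
qed

section \<open>Long division\<close>

lemma cancel_leading_component:
  assumes cyclic: homogeneous_cyclic
    and u: "u \<in> carrier M" and v: "v \<in> carrier M" "v \<noteq> \<zero>\<^bsub>M\<^esub>"
    and le: "graded_deg M Mgr v \<le> graded_deg M Mgr u"
  obtains a w where "a \<in> carrier R" "w \<in> carrier M" "u = a \<odot>\<^bsub>M\<^esub> v \<oplus>\<^bsub>M\<^esub> w"
    "w = \<zero>\<^bsub>M\<^esub> \<or> graded_deg M Mgr w < graded_deg M Mgr u"
proof -
  let ?i = "graded_deg M Mgr v" and ?j = "graded_deg M Mgr u"
  have "N.comp v ?i \<in> Mgr ?i - {\<zero>\<^bsub>M\<^esub>}"
    using v N.comp_in_Gr N.comp_deg_nonzero by simp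
  then have "Mgr ?j = {a \<odot>\<^bsub>M\<^esub> N.comp v ?i | a. a \<in> Rgr (?j - ?i)}"
    using cyclic le by blast
  \<comment> \<open>Since a is homogeneous, multiplying v by a only shifts degrees: the leading
    component of v lands on that of u, and nothing lands above it.\<close>
  then obtain a where a: "a \<in> Rgr (?j - ?i)" and lead: "N.comp u ?j = a \<odot>\<^bsub>M\<^esub> N.comp v ?i"
    using N.comp_in_Gr[OF u, of ?j] by blast
  define w where "w = u \<ominus>\<^bsub>M\<^esub> a \<odot>\<^bsub>M\<^esub> v"
  have av: "a \<odot>\<^bsub>M\<^esub> v \<in> carrier M" using a v A.Gr_carrier by simp
  then have w: "w \<in> carrier M" using u by (simp add: w_def)
  have eq: "u = a \<odot>\<^bsub>M\<^esub> v \<oplus>\<^bsub>M\<^esub> w"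
    using u av by (simp add: w_def M.minus_eq M.a_lcomm M.r_neg)
  have "N.comp w n = \<zero>\<^bsub>M\<^esub>" if "?j \<le> n" for n
  proof -
    \<comment> \<open>The degree in v that multiplication by a moves to n; it is at least deg v
      because n is at least deg u.\<close>
    define k where "k = n - (?j - ?i)"
    have n: "n = (?j - ?i) + k" "?i \<le> k" using that le by (auto simp: k_def)
    have "N.comp (a \<odot>\<^bsub>M\<^esub> v) n = a \<odot>\<^bsub>M\<^esub> N.comp v k"
      using comp_smult_left[OF a v(1)] n by simp
    also have "\<dots> = N.comp u n"
    proof (cases "n = ?j")
      case True
      then have "k = ?i" using n le by simp
      then show ?thesis using True lead by simp
    next
      case False
      then have "?j < n" "?i < k" using that n le by auto
      moreover have "a \<odot>\<^bsub>M\<^esub> \<zero>\<^bsub>M\<^esub> = \<zero>\<^bsub>M\<^esub>"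
        using comp_smult_left[OF a, of "\<zero>\<^bsub>M\<^esub>" 0] smult_r_distr[of a "\<zero>\<^bsub>M\<^esub>" "\<zero>\<^bsub>M\<^esub>"] a A.Gr_carrier
        by simp
      ultimately show ?thesis using N.comp_above_deg u v by simp
    qed
    finally have "N.comp u n = N.comp u n \<oplus>\<^bsub>M\<^esub> N.comp w n"
      using N.comp_add[OF av w, of n] eq by simp
    then show ?thesis using u w by simp
  qed
  then show thesis
    using that[of a w] a w eq N.deg_lessI[OF w] A.Gr_carrier by blast
qed

lemma euclidean_if_homogeneous_cyclic:
  assumes homogeneous_cyclic
  shows "euclidean_module R M (graded_deg M Mgr)"
proof unfold_locales
  fix u v
  assume "u \<in> carrier M - {\<zero>\<^bsub>M\<^esub>}" and "v \<in> carrier M - {\<zero>\<^bsub>M\<^esub>}"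
  then have u: "u \<in> carrier M" and v: "v \<in> carrier M" "v \<noteq> \<zero>\<^bsub>M\<^esub>" by auto
  \<comment> \<open>The induction ranges over the whole carrier; u = 0 does no harm, whatever its
    unspecified degree is.\<close>
  from u show "\<exists>q\<in>carrier R. \<exists>r\<in>carrier M. u = q \<odot>\<^bsub>M\<^esub> v \<oplus>\<^bsub>M\<^esub> r \<and>
    (r = \<zero>\<^bsub>M\<^esub> \<or> graded_deg M Mgr r < graded_deg M Mgr v)"
  proof (induction "graded_deg M Mgr u" arbitrary: u rule: less_induct)
    case less
    show ?case
    proof (cases "graded_deg M Mgr u < graded_deg M Mgr v")
      case True
      moreover have "u = \<zero> \<odot>\<^bsub>M\<^esub> v \<oplus>\<^bsub>M\<^esub> u" using less.prems v by simp
      ultimately show ?thesis using less.prems A.Gr_carrier[OF A.Gr_zero[of 0]] by blast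
    next
      case False
      then have le: "graded_deg M Mgr v \<le> graded_deg M Mgr u" by simp
      obtain a w where a: "a \<in> carrier R" and w: "w \<in> carrier M"
        and u: "u = a \<odot>\<^bsub>M\<^esub> v \<oplus>\<^bsub>M\<^esub> w"
        and deg: "w = \<zero>\<^bsub>M\<^esub> \<or> graded_deg M Mgr w < graded_deg M Mgr u"
        using cancel_leading_component[OF assms less.prems v le] .
      show ?thesis
      \<comment> \<open>The degree is known to drop only for nonzero w, so the induction hypothesis
        is reserved for that case.\<close>
      proof (cases "w = \<zero>\<^bsub>M\<^esub>")
        case True
        then show ?thesis using a u by blast
      next
        case False
        then obtain q r where q: "q \<in> carrier R" and r: "r \<in> carrier M"
          and wqr: "w = q \<odot>\<^bsub>M\<^esub> v \<oplus>\<^bsub>M\<^esub> r"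
          and "r = \<zero>\<^bsub>M\<^esub> \<or> graded_deg M Mgr r < graded_deg M Mgr v"
          using less.hyps[of w] w deg by blast
        \<comment> \<open>The quotient of u is the one for w plus the scalar that cancelled the
          leading component.\<close>
        moreover have "u = (a \<oplus> q) \<odot>\<^bsub>M\<^esub> v \<oplus>\<^bsub>M\<^esub> r"
          using a q r v unfolding u wqr by (simp add: smult_l_distr M.a_assoc)
        ultimately show ?thesis using a by blast
      qed
    qed
  qed
qed

section \<open>Simplicity of the components over the degree-zero ring\<close>

lemma left_module_component: "left_module (R\<lparr>carrier := Rgr 0\<rparr>) (M\<lparr>carrier := Mgr i\<rparr>)"
proof -
  have neg: "\<And>x. x \<in> Mgr i \<Longrightarrow> \<ominus>\<^bsub>M\<^esub> x \<in> Mgr i"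
    using additive_subgroup.a_inv_closed[OF N.additive_subgroup_Gr] .
  have "abelian_group (M\<lparr>carrier := Mgr i\<rparr>)"
    by (intro abelian_groupI)
      (auto simp: N.Gr_add N.Gr_carrier M.a_assoc M.a_comm M.a_lcomm intro!: bexI[of _ "\<ominus>\<^bsub>M\<^esub> x" for x] M.r_neg neg)
  moreover have "left_module_axioms (R\<lparr>carrier := Rgr 0\<rparr>) (M\<lparr>carrier := Mgr i\<rparr>)"
    using graded_smult[of _ 0 _ i]
    by unfold_locales
      (auto simp: A.Gr_carrier N.Gr_carrier smult_l_distr smult_r_distr smult_assoc1)
  ultimately show ?thesis by (intro left_module.intro ring_degree_zero)
qed

lemma simple_component:
  assumes cyclic: homogeneous_cyclic and "Mgr i \<noteq> {\<zero>\<^bsub>M\<^esub>}"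
  shows "simple_module (R\<lparr>carrier := Rgr 0\<rparr>) (M\<lparr>carrier := Mgr i\<rparr>)"
proof (intro simple_module.intro left_module_component simple_module_axioms.intro)
  show "carrier (M\<lparr>carrier := Mgr i\<rparr>) \<noteq> {\<zero>\<^bsub>M\<lparr>carrier := Mgr i\<rparr>\<^esub>}"
    using assms(2) by simp
next
  fix L
  assume "submodule L (R\<lparr>carrier := Rgr 0\<rparr>) (M\<lparr>carrier := Mgr i\<rparr>)"
  then interpret L: submodule L "R\<lparr>carrier := Rgr 0\<rparr>" "M\<lparr>carrier := Mgr i\<rparr>" .
  have sub: "L \<subseteq> Mgr i" and zero: "\<zero>\<^bsub>M\<^esub> \<in> L"
    \<comment> \<open>A submodule is a subgroup of the additive monoid, whose unit is zero.\<close>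
    using L.subset L.one_closed by auto
  have "Mgr i \<subseteq> L" if nontrivial: "L \<noteq> {\<zero>\<^bsub>M\<^esub>}"
  proof -
    obtain m where m: "m \<in> L" "m \<noteq> \<zero>\<^bsub>M\<^esub>" using nontrivial zero by blast
    \<comment> \<open>Taking j = i leaves scalars of degree 0, under which L is closed, so one
      nonzero m in L forces all of \<open>Mgr i\<close> into L.\<close>
    then have "Mgr i = {a \<odot>\<^bsub>M\<^esub> m | a. a \<in> Rgr (i - i)}"
      using cyclic sub by blast
    then show ?thesis using L.smult_closed[of _ m] m by auto
  qed
  then show "L = {\<zero>\<^bsub>M\<lparr>carrier := Mgr i\<rparr>\<^esub>} \<or> L = carrier (M\<lparr>carrier := Mgr i\<rparr>)"
    using sub by auto
qed

end

text \<open>Simplicity is claimed for the nonzero components: a field concentrated in degree 0, as a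
  module over itself, is Euclidean with zero components in all positive degrees.\<close>

theorem theorem3p4:
  fixes A :: "('a, 'r) ring_scheme"
    and Agr :: "nat \<Rightarrow> 'a set"
    and M :: "('a, 'm, 's) module_scheme"
    and Mgr :: "nat \<Rightarrow> 'm set"
  assumes "graded_module A Agr M Mgr"
  shows "(euclidean_module A M (graded_deg M Mgr) \<longleftrightarrow>
           (\<forall>i j. i \<le> j \<longrightarrow> (\<forall>m \<in> Mgr i - {\<zero>\<^bsub>M\<^esub>}.
              Mgr j = {a \<odot>\<^bsub>M\<^esub> m | a. a \<in> Agr (j - i)})))
       \<and> (euclidean_module A M (graded_deg M Mgr) \<longrightarrow>
           (\<forall>i. Mgr i \<noteq> {\<zero>\<^bsub>M\<^esub>} \<longrightarrow>
              simple_module (A\<lparr>carrier := Agr 0\<rparr>) (M\<lparr>carrier := Mgr i\<rparr>)))"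
proof -
  interpret graded_module A Agr M Mgr by fact
  show ?thesis
    using homogeneous_cyclic_if_euclidean euclidean_if_homogeneous_cyclic simple_component
    by blast
qed

end
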